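(* For bounded real-valued random variables $X$ and $Y$ with i.i.d. copies $(X_i)_{i\in\mathbb{N}}$ of $X$ and $(Y_i)_{i\in\mathbb{N}}$ of $Y$, we have $$\sup_{\varepsilon>0}\ \overline{\lim}_{n\to\infty}\ \sup_{c\in\mathbb{R}}\ \frac1n\log\frac{\mathbf{P}\left[\frac1n\sum_{i=1}^n X_i\ge c\right]}{\mathbf{P}\left[\frac1n\sum_{i=1}^n Y_i\ge c-\varepsilon\right]} \;=\; \sup_{t\ge0}\ \log\frac{\mathbb{E}[e^{tX}]}{\mathbb{E}[e^{tY}]},$$ where this equation holds in two versions: with $\overline{\lim}_{n\to\infty}$ standing for $\liminf_{n\to\infty}$, and with it standing for $\limsup_{n\to\infty}$.
   Context: Both sides take values in the extended reals. The fraction on the left-hand side is understood to be $\infty$ if its denominator vanishes and its numerator does not, and $\frac00:=0$ (so that those $c$ for which both vanish do not contribute to the supremum); $\log 0=-\infty$ and $\log\infty=\infty$. *)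

theory Defs
  imports "HOL-Probability.Probability"
begin

(* Negative arguments never arise below; the value there is a convention. *)
definition ext_log :: "ereal \<Rightarrow> ereal" where
  "ext_log x = (if x \<le> 0 then -\<infinity> else if x = \<infinity> then \<infinity> else ereal (ln (real_of_ereal x)))"

(* Boundedness up to a null set; pointwise boundedness is a special case. *)
definition bounded_rv :: "'a measure \<Rightarrow> ('a \<Rightarrow> real) \<Rightarrow> bool" where
  "bounded_rv M X \<longleftrightarrow> X \<in> borel_measurable M \<and> (\<exists>B. AE \<omega> in M. \<bar>X \<omega>\<bar> \<le> B)"

(* The copies are indexed by 1, 2, ...; they may live on a different
   probability space than X itself. *)
definition iid_copies ::
    "'b measure \<Rightarrow> (nat \<Rightarrow> 'b \<Rightarrow> real) \<Rightarrow> 'a measure \<Rightarrow> ('a \<Rightarrow> real) \<Rightarrow> bool" where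
  "iid_copies M' Xs M X \<longleftrightarrow>
     prob_space.indep_vars M' (\<lambda>_. borel) Xs {1..} \<and>
     (\<forall>i\<ge>1. distr M' borel (Xs i) = distr M borel X)"

definition avg :: "(nat \<Rightarrow> 'b \<Rightarrow> real) \<Rightarrow> nat \<Rightarrow> 'b \<Rightarrow> real" where
  "avg Xs n \<omega> = (1 / real n) * (\<Sum>i=1..n. Xs i \<omega>)"

(* Division on ereal follows exactly the conventions needed for the quotient
   of the two tail probabilities. *)
lemma ereal_quotient_conventions:
  fixes p :: real
  shows "ereal 0 / ereal 0 = 0"
    and "0 < p \<Longrightarrow> ereal p / ereal 0 = \<infinity>"
  by (simp_all add: divide_ereal_def zero_ereal_def[symmetric])

definition log_tail_ratio ::
    "'b measure \<Rightarrow> (nat \<Rightarrow> 'b \<Rightarrow> real) \<Rightarrow> 'd measure \<Rightarrow> (nat \<Rightarrow> 'd \<Rightarrow> real) \<Rightarrow>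
     real \<Rightarrow> nat \<Rightarrow> real \<Rightarrow> ereal" where
  "log_tail_ratio M Xs N Ys \<epsilon> n c =
     ereal (1 / real n) *
     ext_log (ereal (\<P>(\<omega> in M. avg Xs n \<omega> \<ge> c)) /
              ereal (\<P>(\<omega> in N. avg Ys n \<omega> \<ge> c - \<epsilon>)))"

end

theory Submission
  imports Defs
begin

text \<open>
  Write \<open>m\<^sub>X\<close>, \<open>m\<^sub>Y\<close> for the moment generating functions. If the tails satisfy
  \<open>P (avg\<^sub>X \<ge> c) \<le> exp (n L) P (avg\<^sub>Y \<ge> c - \<epsilon>)\<close> for all \<open>c\<close> and a single \<open>n\<close>, integrating against
  \<open>n t exp (n t c) dc\<close> gives \<open>m\<^sub>X t \<le> exp (L + t \<epsilon>) m\<^sub>Y t\<close>; this is the lower bound for the limits.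
  Conversely, if \<open>m\<^sub>X \<le> exp R m\<^sub>Y\<close> on \<open>{0..}\<close>, the Chernoff bound for the \<open>X\<close>-tail at \<open>c\<close> is at most
  \<open>exp (n R)\<close> times the Chernoff bound for the \<open>Y\<close>-tail at \<open>c\<close>, which by Cramer's theorem is attained
  by the \<open>Y\<close>-tail at \<open>c - \<epsilon>\<close> to exponential order. Moving the threshold down makes the function
  \<open>ln m\<^sub>Y t - t (c - \<eta>)\<close> coercive, so that an optimal tilting parameter exists without any condition
  on \<open>c\<close>.
\<close>

section \<open>Moment generating functions of bounded random variables\<close>

abbreviation mgf :: "'a measure \<Rightarrow> ('a \<Rightarrow> real) \<Rightarrow> real \<Rightarrow> real" where
  "mgf M X t \<equiv> (\<integral>\<omega>. exp (t * X \<omega>) \<partial>M)"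

text \<open>Provides the dominating bound for the difference quotients in
  \<open>mgf_has_real_derivative\<close>.\<close>

lemma abs_exp_minus_one_le:
  fixes y :: real
  shows "\<bar>exp y - 1\<bar> \<le> \<bar>y\<bar> * exp \<bar>y\<bar>"
proof (cases "y \<ge> 0")
  case True
  have "exp y * (1 - y) \<le> exp y * exp (- y)"
    using exp_ge_add_one_self[of "- y"] by (intro mult_left_mono) auto
  with True show ?thesis
    by (simp add: exp_minus algebra_simps)
next
  case False
  then have "1 - exp y \<le> \<bar>y\<bar> * 1"
    using exp_ge_add_one_self[of y] by linarith
  also have "\<dots> \<le> \<bar>y\<bar> * exp \<bar>y\<bar>"
    by (intro mult_left_mono) auto
  finally show ?thesis
    using False by simp
qed

context prob_space
begin

lemma bounded_rv_measurable: "bounded_rv M X \<Longrightarrow> X \<in> borel_measurable M"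
  by (simp add: bounded_rv_def)

text \<open>A single bound serves all \<open>t\<close>. Passing to \<open>max B 0\<close> makes it
  nonnegative without an argument about the almost sure bound itself.\<close>

lemma bounded_rv_exp_le:
  assumes "bounded_rv M X"
  obtains B where "B \<ge> 0" "AE \<omega> in M. \<bar>X \<omega>\<bar> \<le> B" "\<And>t. AE \<omega> in M. exp (t * X \<omega>) \<le> exp (\<bar>t\<bar> * B)"
proof -
  obtain B where B: "AE \<omega> in M. \<bar>X \<omega>\<bar> \<le> B"
    using assms by (auto simp: bounded_rv_def)
  have "AE \<omega> in M. exp (t * X \<omega>) \<le> exp (\<bar>t\<bar> * max B 0)" for t
    using B
  proof eventually_elim
    case (elim \<omega>)
    have "t * X \<omega> \<le> \<bar>t\<bar> * \<bar>X \<omega>\<bar>"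
      by (metis abs_ge_self abs_mult)
    also have "\<dots> \<le> \<bar>t\<bar> * max B 0"
      using elim by (intro mult_left_mono) auto
    finally show ?case by simp
  qed
  moreover have "AE \<omega> in M. \<bar>X \<omega>\<bar> \<le> max B 0"
    using B by eventually_elim auto
  ultimately show ?thesis
    using that[of "max B 0"] by auto
qed

lemma integrable_exp_bounded_rv:
  assumes "bounded_rv M X"
  shows "integrable M (\<lambda>\<omega>. exp (t * X \<omega>))"
proof -
  note [measurable] = bounded_rv_measurable[OF assms]
  obtain B where "\<And>t. AE \<omega> in M. exp (t * X \<omega>) \<le> exp (\<bar>t\<bar> * B)"
    using bounded_rv_exp_le[OF assms] by metis
  then show ?thesis
    by (intro integrable_const_bound[where B = "exp (\<bar>t\<bar> * B)"]) auto
qed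

lemma mgf_pos:
  assumes "bounded_rv M X"
  shows "mgf M X t > 0"
proof -
  have "mgf M X t \<noteq> 0"
    using integral_nonneg_eq_0_iff_AE[OF integrable_exp_bounded_rv[OF assms, of t]] by auto
  moreover have "mgf M X t \<ge> 0"
    by simp
  ultimately show ?thesis by linarith
qed

text \<open>Differentiation under the integral sign: along any sequence of nonzero increments
  tending to 0 the difference quotients converge pointwise and are dominated by a constant, which is
  integrable on a probability space.\<close>

lemma mgf_has_real_derivative:
  assumes X: "bounded_rv M X"
  shows "(mgf M X has_real_derivative (\<integral>\<omega>. X \<omega> * exp (t * X \<omega>) \<partial>M)) (at t)"
  unfolding DERIV_def tendsto_at_iff_sequentially comp_def
proof (intro allI impI)
  fix h :: "nat \<Rightarrow> real"
  assume "\<forall>i. h i \<in> UNIV - {0}" and h0: "h \<longlonglongrightarrow> 0"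
  then have hn0: "h i \<noteq> 0" for i by auto
  note [measurable] = bounded_rv_measurable[OF X]
  obtain B where B: "B \<ge> 0" "AE \<omega> in M. \<bar>X \<omega>\<bar> \<le> B"
      "\<And>t. AE \<omega> in M. exp (t * X \<omega>) \<le> exp (\<bar>t\<bar> * B)"
    using bounded_rv_exp_le[OF X] by metis
  \<comment> \<open>The dominating function must not depend on \<open>i\<close>, so the whole
    sequence of increments is bounded by one \<open>K\<close>.\<close>
  obtain K where K: "\<And>i. \<bar>h i\<bar> \<le> K"
    using convergent_imp_Bseq[OF convergentI[OF h0]] by (auto simp: Bseq_def)
  have "(\<lambda>i. \<integral>\<omega>. exp (t * X \<omega>) * ((exp (h i * X \<omega>) - 1) / h i) \<partial>M)
      \<longlonglongrightarrow> (\<integral>\<omega>. X \<omega> * exp (t * X \<omega>) \<partial>M)"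
  proof (rule integral_dominated_convergence[where w = "\<lambda>_. exp (\<bar>t\<bar> * B) * (B * exp (K * B))"])
    show "AE \<omega> in M. (\<lambda>i. exp (t * X \<omega>) * ((exp (h i * X \<omega>) - 1) / h i)) \<longlonglongrightarrow> X \<omega> * exp (t * X \<omega>)"
    proof (rule AE_I2)
      fix \<omega>
      have "((\<lambda>s. exp (s * X \<omega>)) has_real_derivative X \<omega>) (at 0)"
        by (auto intro!: derivative_eq_intros)
      then have "((\<lambda>s. (exp (s * X \<omega>) - 1) / s) \<longlongrightarrow> X \<omega>) (at 0)"
        by (simp add: DERIV_def)
      then have "(\<lambda>i. (exp (h i * X \<omega>) - 1) / h i) \<longlonglongrightarrow> X \<omega>"
        using h0 hn0 by (auto simp: tendsto_at_iff_sequentially comp_def)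
      from tendsto_mult[OF tendsto_const this]
      show "(\<lambda>i. exp (t * X \<omega>) * ((exp (h i * X \<omega>) - 1) / h i)) \<longlonglongrightarrow> X \<omega> * exp (t * X \<omega>)"
        by (metis mult.commute)
    qed
  next
    fix i
    show "AE \<omega> in M. norm (exp (t * X \<omega>) * ((exp (h i * X \<omega>) - 1) / h i))
        \<le> exp (\<bar>t\<bar> * B) * (B * exp (K * B))"
      using B(2) B(3)[of t]
    proof eventually_elim
      case (elim \<omega>)
      have "\<bar>exp (h i * X \<omega>) - 1\<bar> \<le> \<bar>h i * X \<omega>\<bar> * exp \<bar>h i * X \<omega>\<bar>"
        by (rule abs_exp_minus_one_le)
      then have "\<bar>(exp (h i * X \<omega>) - 1) / h i\<bar> \<le> \<bar>X \<omega>\<bar> * exp (\<bar>h i\<bar> * \<bar>X \<omega>\<bar>)"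
        using hn0[of i] by (simp add: abs_mult field_simps)
      also have "\<dots> \<le> B * exp (K * B)"
        using elim K[of i] B(1) by (intro mult_mono) (auto intro!: mult_mono intro: order_trans[OF abs_ge_zero])
      finally have "exp (t * X \<omega>) * \<bar>(exp (h i * X \<omega>) - 1) / h i\<bar> \<le> exp (\<bar>t\<bar> * B) * (B * exp (K * B))"
        using elim by (intro mult_mono) auto
      then show ?case
        by (simp add: abs_mult)
    qed
  qed auto
  moreover have "(\<integral>\<omega>. exp (t * X \<omega>) * ((exp (h i * X \<omega>) - 1) / h i) \<partial>M)
      = (mgf M X (t + h i) - mgf M X t) / h i" for i
  proof -
    have "(\<integral>\<omega>. exp (t * X \<omega>) * ((exp (h i * X \<omega>) - 1) / h i) \<partial>M)
        = (\<integral>\<omega>. (exp ((t + h i) * X \<omega>) - exp (t * X \<omega>)) / h i \<partial>M)"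
      by (intro Bochner_Integration.integral_cong) (auto simp: exp_add algebra_simps diff_divide_distrib)
    also have "\<dots> = (mgf M X (t + h i) - mgf M X t) / h i"
      by (simp add: Bochner_Integration.integral_diff integrable_exp_bounded_rv[OF X])
    finally show ?thesis .
  qed
  ultimately show "(\<lambda>i. (mgf M X (t + h i) - mgf M X t) / h i) \<longlonglongrightarrow> (\<integral>\<omega>. X \<omega> * exp (t * X \<omega>) \<partial>M)"
    by (simp only:)
qed

section \<open>Exponential tail estimates for a single random variable\<close>

text \<open>Markov's inequality for \<open>exp (t * S \<omega>)\<close>: the indicator of the tail
  lies below \<open>exp (t * (S \<omega> - a))\<close>.\<close>

lemma chernoff_bound:
  assumes "S \<in> borel_measurable M" "integrable M (\<lambda>\<omega>. exp (t * S \<omega>))" "t \<ge> 0"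
  shows "prob {\<omega> \<in> space M. S \<omega> \<ge> a} \<le> mgf M S t * exp (- t * a)"
proof -
  note [measurable] = assms(1)
  have "prob {\<omega> \<in> space M. S \<omega> \<ge> a} = (\<integral>\<omega>. indicator {\<omega> \<in> space M. S \<omega> \<ge> a} \<omega> \<partial>M)"
    by simp
  also have "\<dots> \<le> (\<integral>\<omega>. exp (t * S \<omega>) * exp (- t * a) \<partial>M)"
  proof (rule integral_mono)
    fix \<omega>
    have "S \<omega> \<ge> a \<Longrightarrow> 1 \<le> exp (t * S \<omega>) * exp (- t * a)"
      using assms(3) by (simp add: exp_add[symmetric] mult_left_mono)
    then show "indicator {\<omega> \<in> space M. S \<omega> \<ge> a} \<omega> \<le> exp (t * S \<omega>) * exp (- t * a)"
      by (auto simp: indicator_def)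
  qed (use assms in \<open>auto intro!: integrable_real_indicator simp: less_top[symmetric]\<close>)
  finally show ?thesis by simp
qed

text \<open>
  Splits the mass that \<open>exp (t S)\<close> puts on the line into the parts below \<open>a\<close>, above \<open>b\<close> and between
  them; the two outer parts are estimated by Chernoff bounds for the exponentially tilted law.
\<close>
lemma mgf_le_window:
  assumes "S \<in> borel_measurable M" "\<And>u. integrable M (\<lambda>\<omega>. exp (u * S \<omega>))"
    and "t \<ge> 0" "r \<ge> 0" "s \<ge> 0"
  shows "mgf M S t \<le> mgf M S (t - r) * exp (r * a) + mgf M S (t + s) * exp (- s * b)
           + exp (t * b) * prob {\<omega> \<in> space M. S \<omega> \<ge> a}"
proof -
  note [measurable] = assms(1)
  have ind: "integrable M (\<lambda>\<omega>. exp (t * b) * indicator {\<omega> \<in> space M. S \<omega> \<ge> a} \<omega>)"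
    by (auto intro!: integrable_real_indicator simp: less_top[symmetric])
  have low: "integrable M (\<lambda>\<omega>. exp ((t - r) * S \<omega>) * exp (r * a))"
    and high: "integrable M (\<lambda>\<omega>. exp ((t + s) * S \<omega>) * exp (- s * b))"
    using assms by auto
  have "mgf M S t \<le> (\<integral>\<omega>. exp ((t - r) * S \<omega>) * exp (r * a) + exp ((t + s) * S \<omega>) * exp (- s * b)
           + exp (t * b) * indicator {\<omega> \<in> space M. S \<omega> \<ge> a} \<omega> \<partial>M)"
  proof (rule integral_mono)
    fix \<omega> assume \<omega>: "\<omega> \<in> space M"
    consider "S \<omega> < a" | "S \<omega> > b" | "S \<omega> \<ge> a" "S \<omega> \<le> b" by linarith
    then show "exp (t * S \<omega>) \<le> exp ((t - r) * S \<omega>) * exp (r * a) + exp ((t + s) * S \<omega>) * exp (- s * b)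
           + exp (t * b) * indicator {\<omega> \<in> space M. S \<omega> \<ge> a} \<omega>"
    proof cases
      case 1
      then have "r * S \<omega> \<le> r * a" using assms(4) by (intro mult_left_mono) auto
      then have "exp (t * S \<omega>) \<le> exp ((t - r) * S \<omega>) * exp (r * a)"
        by (simp add: exp_add[symmetric] algebra_simps)
      then show ?thesis by (simp add: add.assoc add_increasing2)
    next
      case 2
      then have "s * b \<le> s * S \<omega>" using assms(5) by (intro mult_left_mono) auto
      then have "exp (t * S \<omega>) \<le> exp ((t + s) * S \<omega>) * exp (- s * b)"
        by (simp add: exp_add[symmetric] algebra_simps)
      then show ?thesis by (simp add: add.assoc add_increasing add_increasing2)
    next
      case 3
      then have "exp (t * S \<omega>) \<le> exp (t * b) * indicator {\<omega> \<in> space M. S \<omega> \<ge> a} \<omega>"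
        using assms(3) \<omega> by (simp add: mult_left_mono)
      then show ?thesis by (simp add: add_increasing)
    qed
  qed (use assms ind in auto)
  also have "\<dots> = mgf M S (t - r) * exp (r * a) + mgf M S (t + s) * exp (- s * b)
           + exp (t * b) * prob {\<omega> \<in> space M. S \<omega> \<ge> a}"
    using Bochner_Integration.integral_add[OF Bochner_Integration.integrable_add[OF low high] ind]
      Bochner_Integration.integral_add[OF low high]
    by simp
  finally show ?thesis .
qed

end

section \<open>From tails to moment generating functions by the layer-cake formula\<close>

text \<open>The exponential is the integral of its own derivative. The reflection of
  \<open>u\<close> turns the half-line into one unbounded above, as
  \<open>nn_integral_FTC_atLeast\<close> requires.\<close>

lemma nn_integral_exp_atMost:
  fixes a s :: real
  assumes "s > 0"
  shows "(\<integral>\<^sup>+u. ennreal (s * exp (s * u)) * indicator {..a} u \<partial>lborel) = exp (s * a)"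
proof -
  have "(\<integral>\<^sup>+u. ennreal (s * exp (s * u)) * indicator {..a} u \<partial>lborel)
      = (\<integral>\<^sup>+v. ennreal (s * exp (s * - v)) * indicator {- a..} v \<partial>lborel)"
    by (subst nn_integral_real_affine[where c = "- 1" and t = 0])
      (auto simp: indicator_def intro!: nn_integral_cong)
  also have "\<dots> = 0 - - exp (s * - (- a))"
  proof (rule nn_integral_FTC_atLeast)
    have "filterlim (\<lambda>v. s * - v) at_bot at_top"
      using filterlim_tendsto_pos_mult_at_top[OF tendsto_const assms filterlim_ident]
      by (simp add: filterlim_uminus_at_bot)
    from tendsto_minus[OF filterlim_compose[OF exp_at_bot this]]
    show "((\<lambda>v. - exp (s * - v)) \<longlongrightarrow> 0) at_top"
      by simp
  qed (use assms in \<open>auto intro!: derivative_eq_intros\<close>)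
  finally show ?thesis by simp
qed

text \<open>Each value \<open>exp (s * A \<omega>)\<close> is written as an integral over
  \<open>u \<le> A \<omega>\<close>; exchanging the two integrals leaves the probability of the tail
  at \<open>u\<close>.\<close>

lemma (in prob_space) nn_integral_exp_layer_cake:
  fixes s :: real
  assumes [measurable]: "A \<in> borel_measurable M" and s: "s > 0"
  shows "(\<integral>\<^sup>+\<omega>. exp (s * A \<omega>) \<partial>M)
    = (\<integral>\<^sup>+u. ennreal (s * exp (s * u)) * ennreal (prob {\<omega> \<in> space M. A \<omega> \<ge> u}) \<partial>lborel)"
proof -
  interpret pair_sigma_finite M lborel
    by unfold_locales
  have "(\<integral>\<^sup>+\<omega>. exp (s * A \<omega>) \<partial>M)
      = (\<integral>\<^sup>+\<omega>. (\<integral>\<^sup>+u. ennreal (s * exp (s * u)) * indicator {\<omega> \<in> space M. A \<omega> \<ge> u} \<omega> \<partial>lborel) \<partial>M)"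
    unfolding nn_integral_exp_atMost[OF s, symmetric]
    by (intro nn_integral_cong) (auto simp: indicator_def)
  also have "\<dots> = (\<integral>\<^sup>+u. (\<integral>\<^sup>+\<omega>. ennreal (s * exp (s * u)) * indicator {\<omega> \<in> space M. A \<omega> \<ge> u} \<omega> \<partial>M) \<partial>lborel)"
    by (rule Fubini'[symmetric]) measurable
  also have "\<dots> = (\<integral>\<^sup>+u. ennreal (s * exp (s * u)) * ennreal (prob {\<omega> \<in> space M. A \<omega> \<ge> u}) \<partial>lborel)"
    by (intro nn_integral_cong) (simp add: nn_integral_cmult emeasure_eq_measure)
  finally show ?thesis .
qed

text \<open>Both sides are layer-cake integrals with weight \<open>s * exp (s * u)\<close>.
  Translating the variable by \<epsilon> in the integral for \<open>C\<close> changes the weight by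
  the factor \<open>exp (s * \<epsilon>)\<close>.\<close>

lemma mgf_le_of_tail_le:
  assumes "prob_space M" "prob_space N"
    and [measurable]: "A \<in> borel_measurable M" "C \<in> borel_measurable N"
    and int: "integrable M (\<lambda>\<omega>. exp (s * A \<omega>))" "integrable N (\<lambda>\<omega>. exp (s * C \<omega>))"
    and s: "s > 0" and K: "K \<ge> 0"
    and le: "\<And>u. \<P>(\<omega> in M. A \<omega> \<ge> u) \<le> K * \<P>(\<omega> in N. C \<omega> \<ge> u - \<epsilon>)"
  shows "mgf M A s \<le> K * exp (s * \<epsilon>) * mgf N C s"
proof -
  interpret M: prob_space M by fact
  interpret N: prob_space N by fact
  have [measurable]: "(\<lambda>u. ennreal (\<P>(\<omega> in N. C \<omega> \<ge> u))) \<in> borel_measurable borel"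
    unfolding N.emeasure_eq_measure[symmetric] by measurable
  have "ennreal (mgf M A s) = (\<integral>\<^sup>+\<omega>. exp (s * A \<omega>) \<partial>M)"
    by (rule nn_integral_eq_integral[symmetric]) (auto simp: int)
  also have "\<dots> = (\<integral>\<^sup>+u. ennreal (s * exp (s * u)) * ennreal (\<P>(\<omega> in M. A \<omega> \<ge> u)) \<partial>lborel)"
    by (rule M.nn_integral_exp_layer_cake) (auto simp: s)
  also have "\<dots> \<le> (\<integral>\<^sup>+u. ennreal (K * exp (s * \<epsilon>)) *
      (ennreal (s * exp (s * (u - \<epsilon>))) * ennreal (\<P>(\<omega> in N. C \<omega> \<ge> u - \<epsilon>))) \<partial>lborel)"
  proof (rule nn_integral_mono)
    fix u
    have "s * exp (s * u) * \<P>(\<omega> in M. A \<omega> \<ge> u) \<le> s * exp (s * u) * (K * \<P>(\<omega> in N. C \<omega> \<ge> u - \<epsilon>))"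
      using s by (intro mult_left_mono le) auto
    also have "\<dots> = (K * exp (s * \<epsilon>)) * (s * exp (s * (u - \<epsilon>)) * \<P>(\<omega> in N. C \<omega> \<ge> u - \<epsilon>))"
      by (simp add: right_diff_distrib exp_diff)
    finally show "ennreal (s * exp (s * u)) * ennreal (\<P>(\<omega> in M. A \<omega> \<ge> u)) \<le> ennreal (K * exp (s * \<epsilon>)) *
      (ennreal (s * exp (s * (u - \<epsilon>))) * ennreal (\<P>(\<omega> in N. C \<omega> \<ge> u - \<epsilon>)))"
      using s K by (simp add: ennreal_mult[symmetric] ennreal_leI)
  qed
  also have "\<dots> = ennreal (K * exp (s * \<epsilon>)) *
      (\<integral>\<^sup>+u. ennreal (s * exp (s * u)) * ennreal (\<P>(\<omega> in N. C \<omega> \<ge> u)) \<partial>lborel)"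
    by (subst (2) nn_integral_real_affine[where c = 1 and t = "- \<epsilon>"]) (auto simp: nn_integral_cmult)
  also have "\<dots> = ennreal (K * exp (s * \<epsilon>)) * (\<integral>\<^sup>+\<omega>. exp (s * C \<omega>) \<partial>N)"
    by (subst N.nn_integral_exp_layer_cake) (auto simp: s)
  also have "(\<integral>\<^sup>+\<omega>. exp (s * C \<omega>) \<partial>N) = ennreal (mgf N C s)"
    by (rule nn_integral_eq_integral) (auto simp: int)
  finally show ?thesis
    using K by (simp add: ennreal_mult[symmetric])
qed

section \<open>Sums of i.i.d. copies\<close>

lemma iid_copies_measurable:
  assumes "prob_space M'" "iid_copies M' Xs M X" "i \<ge> 1"
  shows "Xs i \<in> borel_measurable M'"
  using assms by (auto simp: iid_copies_def prob_space.indep_vars_def)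

text \<open>Independence factorizes the exponential of the sum. Since the copies may live on another
  space than \<open>X\<close>, integrability and the value of each factor are transported through
  the common distribution on the reals.\<close>

lemma iid_copies_mgf_sum:
  assumes "prob_space M" "prob_space M'" and X: "bounded_rv M X" and iid: "iid_copies M' Xs M X"
  shows iid_copies_integrable_exp_sum: "integrable M' (\<lambda>\<omega>. exp (t * (\<Sum>i=1..n. Xs i \<omega>)))"
    and iid_copies_mgf_sum_eq: "mgf M' (\<lambda>\<omega>. \<Sum>i=1..n. Xs i \<omega>) t = mgf M X t ^ n"
    and iid_copies_measurable_sum: "(\<lambda>\<omega>. \<Sum>i=1..n. Xs i \<omega>) \<in> borel_measurable M'"
proof -
  interpret M: prob_space M by fact
  interpret M': prob_space M' by fact
  have X_meas: "X \<in> borel_measurable M"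
    using X by (simp add: bounded_rv_def)
  have distr: "distr M' borel (Xs i) = distr M borel X"
    and Xs_meas: "Xs i \<in> borel_measurable M'" if "i \<in> {1..n}" for i
    using iid that iid_copies_measurable[OF assms(2) iid] by (auto simp: iid_copies_def)
  show "(\<lambda>\<omega>. \<Sum>i=1..n. Xs i \<omega>) \<in> borel_measurable M'"
    using Xs_meas by (intro borel_measurable_sum)
  have "M'.indep_vars (\<lambda>_. borel) Xs {1..n}"
    using iid by (auto simp: iid_copies_def intro: M'.indep_vars_subset)
  then have "M'.indep_vars (\<lambda>_. borel) (\<lambda>i \<omega>. exp (t * Xs i \<omega>)) {1..n}"
    by (rule M'.indep_vars_compose2) auto
  moreover have int: "integrable M' (\<lambda>\<omega>. exp (t * Xs i \<omega>))" if "i \<in> {1..n}" for i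
  proof -
    have "integrable (distr M borel X) (\<lambda>x. exp (t * x))"
      using M.integrable_exp_bounded_rv[OF X] X_meas by (simp add: integrable_distr_eq)
    then have "integrable (distr M' borel (Xs i)) (\<lambda>x. exp (t * x))"
      by (simp only: distr[OF that])
    then show ?thesis
      using Xs_meas[OF that] by (simp add: integrable_distr_eq)
  qed
  ultimately have "integrable M' (\<lambda>\<omega>. \<Prod>i=1..n. exp (t * Xs i \<omega>))"
    and eq: "(\<integral>\<omega>. (\<Prod>i=1..n. exp (t * Xs i \<omega>)) \<partial>M') = (\<Prod>i=1..n. mgf M' (Xs i) t)"
    by (auto intro!: M'.indep_vars_integrable M'.indep_vars_lebesgue_integral)
  then show "integrable M' (\<lambda>\<omega>. exp (t * (\<Sum>i=1..n. Xs i \<omega>)))"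
    by (simp add: sum_distrib_left exp_sum)
  have "mgf M' (Xs i) t = mgf M X t" if "i \<in> {1..n}" for i
  proof -
    have "mgf M' (Xs i) t = (\<integral>x. exp (t * x) \<partial>distr M' borel (Xs i))"
      using Xs_meas[OF that] by (simp add: integral_distr)
    also have "\<dots> = (\<integral>x. exp (t * x) \<partial>distr M borel X)"
      by (simp only: distr[OF that])
    finally show ?thesis
      using X_meas by (simp add: integral_distr)
  qed
  then show "mgf M' (\<lambda>\<omega>. \<Sum>i=1..n. Xs i \<omega>) t = mgf M X t ^ n"
    using eq by (simp add: sum_distrib_left exp_sum)
qed

lemma avg_ge_iff: "n > 0 \<Longrightarrow> avg Xs n \<omega> \<ge> c \<longleftrightarrow> (\<Sum>i=1..n. Xs i \<omega>) \<ge> real n * c"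
  by (simp add: avg_def field_simps)

section \<open>Exponential tilting and the lower bound of Cramer's theorem\<close>

text \<open>The hypothesis \<open>le\<close> bounds \<open>ln (mgf M X u) - u * c\<close> from
  below, so with \<open>c - \<eta>\<close> in place of \<open>c\<close> the function grows at least
  linearly and attains its minimum on the half-line. The conclusion states the first-order
  conditions there: the slope \<open>m\<close> equals \<open>c - \<eta>\<close> at an interior
  minimum and may exceed it only at \<open>t = 0\<close>.\<close>

lemma (in prob_space) exists_tilting_parameter:
  assumes X: "bounded_rv M X" and l: "l > 0" and le: "\<And>t. t \<ge> 0 \<Longrightarrow> l \<le> mgf M X t * exp (- t * c)"
    and \<eta>: "\<eta> > 0"
  obtains t m where "t \<ge> 0" "m \<ge> c - \<eta>" "t * m = t * (c - \<eta>)"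
    "((\<lambda>u. ln (mgf M X u)) has_real_derivative m) (at t)"
proof -
  define f where "f u = ln (mgf M X u) - u * (c - \<eta>)" for u
  define m where "m u = inverse (mgf M X u) * (\<integral>\<omega>. X \<omega> * exp (u * X \<omega>) \<partial>M)" for u
  have m: "((\<lambda>u. ln (mgf M X u)) has_real_derivative m u) (at u)" for u
    unfolding m_def
    using DERIV_chain2[OF DERIV_ln[OF mgf_pos[OF X]] mgf_has_real_derivative[OF X]] .
  then have f': "(f has_real_derivative m u - (c - \<eta>)) (at u)" for u
    using DERIV_diff[OF m DERIV_cmult_right[OF DERIV_ident, of "c - \<eta>"]]
    unfolding f_def by simp
  then have cont: "continuous_on A f" for A
    by (meson DERIV_isCont continuous_at_imp_continuous_on)
  have f_ge: "f u \<ge> ln l + u * \<eta>" if "u \<ge> 0" for u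
  proof -
    have "ln l \<le> ln (mgf M X u * exp (- u * c))"
      using le[OF that] l by (intro ln_mono) auto
    also have "\<dots> = ln (mgf M X u) - u * c"
      using mgf_pos[OF X, of u] by (simp add: ln_mult)
    finally show ?thesis
      by (simp add: f_def algebra_simps)
  qed
  have f0: "f 0 = 0"
    by (simp add: f_def prob_space)
  \<comment> \<open>Beyond \<open>T\<close> the linear lower bound \<open>ln l + u * \<eta>\<close>
    is at least \<open>0 = f 0\<close>, so a minimum over \<open>{0..T}\<close> is a minimum over
    the half-line.\<close>
  define T where "T = \<bar>ln l\<bar> / \<eta>"
  have "T \<ge> 0"
    using \<eta> by (simp add: T_def)
  then obtain t where t: "t \<in> {0..T}" "\<And>u. u \<in> {0..T} \<Longrightarrow> f t \<le> f u"
    using continuous_attains_inf[of "{0..T}" f] cont by auto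
  have min: "f t \<le> f u" if "u \<ge> 0" for u
  proof (cases "u \<le> T")
    case False
    then have "u * \<eta> \<ge> \<bar>ln l\<bar>"
      using \<eta> by (simp add: T_def field_simps)
    then have "f u \<ge> f 0"
      using f_ge[OF that] f0 by linarith
    moreover have "f t \<le> f 0"
      using t(2)[of 0] \<open>T \<ge> 0\<close> by simp
    ultimately show ?thesis by linarith
  qed (use t(2) that in auto)
  have "m t \<ge> c - \<eta>"
  proof (rule ccontr)
    assume "\<not> m t \<ge> c - \<eta>"
    then obtain d where d: "d > 0" "\<forall>h>0. h < d \<longrightarrow> f (t + h) < f t"
      using DERIV_neg_dec_right[OF f'[of t]] by auto
    then have "f (t + d / 2) < f t" by simp
    moreover have "f t \<le> f (t + d / 2)"
      using d t(1) by (intro min) auto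
    ultimately show False by simp
  qed
  moreover have "t * m t = t * (c - \<eta>)"
  proof (cases "t = 0")
    case False
    then have "t > 0" using t(1) by auto
    then have "m t - (c - \<eta>) = 0"
      using min by (intro DERIV_local_min[OF f'[of t], of t]) auto
    then show ?thesis by simp
  qed simp
  ultimately show ?thesis
    using that[of t "m t"] t(1) m by auto
qed

text \<open>The tilted law has mean \<open>m\<close>, so the tilted averages concentrate at \<open>m\<close>.\<close>
lemma eventually_tail_ge_tilted:
  assumes "prob_space N" "prob_space N'" and Y: "bounded_rv N Y" and iid: "iid_copies N' Ys N Y"
    and t: "t \<ge> 0" and m: "((\<lambda>u. ln (mgf N Y u)) has_real_derivative m) (at t)" and \<kappa>: "\<kappa> > 0"
  shows "\<forall>\<^sub>F n in sequentially.
    (mgf N Y t * exp (- t * (m + \<kappa>))) ^ n / 2 \<le> \<P>(\<omega> in N'. avg Ys n \<omega> \<ge> m - \<kappa>)"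
proof -
  interpret N: prob_space N by fact
  interpret N': prob_space N' by fact
  note pos = N.mgf_pos[OF Y]
  \<comment> \<open>The tilted law has mean strictly below \<open>m + \<kappa>\<close>, so a small
    increase of the parameter makes its Chernoff bound above \<open>m + \<kappa>\<close> nontrivial.
    Below, a decrease by \<open>r\<close> does the same for the part under
    \<open>m - \<kappa>\<close>.\<close>
  have "((\<lambda>u. ln (mgf N Y u) - u * (m + \<kappa>)) has_real_derivative - \<kappa>) (at t)"
    using DERIV_diff[OF m DERIV_cmult_right[OF DERIV_ident, of "m + \<kappa>"]] by simp
  from DERIV_neg_dec_right[OF this] \<kappa>
  obtain d where "d > 0" "\<forall>h>0. h < d \<longrightarrow>
      ln (mgf N Y (t + h)) - (t + h) * (m + \<kappa>) < ln (mgf N Y t) - t * (m + \<kappa>)"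
    by auto
  then obtain s where s: "s > 0"
      "ln (mgf N Y (t + s)) - (t + s) * (m + \<kappa>) < ln (mgf N Y t) - t * (m + \<kappa>)"
    by (metis field_lbound_gt_zero)
  have "((\<lambda>u. ln (mgf N Y u) - u * (m - \<kappa>)) has_real_derivative \<kappa>) (at t)"
    using DERIV_diff[OF m DERIV_cmult_right[OF DERIV_ident, of "m - \<kappa>"]] by simp
  from DERIV_pos_inc_left[OF this \<kappa>]
  obtain d where "d > 0" "\<forall>h>0. h < d \<longrightarrow>
      ln (mgf N Y (t - h)) - (t - h) * (m - \<kappa>) < ln (mgf N Y t) - t * (m - \<kappa>)"
    by auto
  then obtain r where r: "r > 0"
      "ln (mgf N Y (t - r)) - (t - r) * (m - \<kappa>) < ln (mgf N Y t) - t * (m - \<kappa>)"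
    by (metis field_lbound_gt_zero)
  \<comment> \<open>\<rho> and \<sigma> are the Chernoff factors per summand, under the tilted law,
    for averages below \<open>m - \<kappa>\<close> and above \<open>m + \<kappa>\<close>.\<close>
  define \<rho> where "\<rho> = mgf N Y (t - r) * exp (r * (m - \<kappa>)) / mgf N Y t"
  define \<sigma> where "\<sigma> = mgf N Y (t + s) * exp (- s * (m + \<kappa>)) / mgf N Y t"
  have "\<rho> = exp (ln (mgf N Y (t - r)) + r * (m - \<kappa>) - ln (mgf N Y t))"
    using pos by (simp add: \<rho>_def exp_add exp_diff)
  moreover have "\<dots> < exp 0"
    using r by (subst exp_less_cancel_iff) (simp add: algebra_simps)
  ultimately have \<rho>: "0 < \<rho>" "\<rho> < 1"
    by simp_all
  have "\<sigma> = exp (ln (mgf N Y (t + s)) + - s * (m + \<kappa>) - ln (mgf N Y t))"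
    using pos by (simp add: \<sigma>_def exp_add exp_diff exp_minus divide_inverse)
  moreover have "\<dots> < exp 0"
    using s by (subst exp_less_cancel_iff) (simp add: algebra_simps)
  ultimately have \<sigma>: "0 < \<sigma>" "\<sigma> < 1"
    by simp_all
  have "(\<lambda>n. \<rho> ^ n + \<sigma> ^ n) \<longlonglongrightarrow> 0 + 0"
    using \<rho> \<sigma> by (intro tendsto_add LIMSEQ_power_zero) auto
  \<comment> \<open>Eventually less than half of the tilted mass lies outside the window; the
    remaining half is the factor \<open>1 / 2\<close> in the claim.\<close>
  then have "\<forall>\<^sub>F n in sequentially. \<rho> ^ n + \<sigma> ^ n < 1 / 2"
    by (rule order_tendstoD) simp
  then show ?thesis
    using eventually_gt_at_top[of 0]
  proof eventually_elim
    case (elim n)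
    define S where "S \<omega> = (\<Sum>i=1..n. Ys i \<omega>)" for \<omega>
    define q where "q = \<P>(\<omega> in N'. avg Ys n \<omega> \<ge> m - \<kappa>)"
    note sum = iid_copies_mgf_sum[OF assms(1,2) Y iid, where n = n, folded S_def]
    have "mgf N' S t \<le> mgf N' S (t - r) * exp (r * (n * (m - \<kappa>)))
        + mgf N' S (t + s) * exp (- s * (n * (m + \<kappa>)))
        + exp (t * (n * (m + \<kappa>))) * N'.prob {\<omega> \<in> space N'. S \<omega> \<ge> n * (m - \<kappa>)}"
      using sum t r s by (intro N'.mgf_le_window) auto
    also have "N'.prob {\<omega> \<in> space N'. S \<omega> \<ge> n * (m - \<kappa>)} = q"
      using elim by (simp add: q_def avg_ge_iff S_def)
    also have "mgf N' S (t - r) * exp (r * (n * (m - \<kappa>))) = mgf N Y t ^ n * \<rho> ^ n"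
      using pos[of t] unfolding sum \<rho>_def
      by (simp add: power_mult_distrib power_divide exp_of_nat_mult[symmetric] mult_ac)
    also have "mgf N' S (t + s) * exp (- s * (n * (m + \<kappa>))) = mgf N Y t ^ n * \<sigma> ^ n"
      using pos[of t] unfolding sum \<sigma>_def
      by (simp add: power_mult_distrib power_divide exp_of_nat_mult[symmetric] mult_ac)
    finally have "mgf N Y t ^ n * (1 - (\<rho> ^ n + \<sigma> ^ n)) \<le> exp (t * (n * (m + \<kappa>))) * q"
      unfolding sum by (simp add: algebra_simps)
    moreover have "mgf N Y t ^ n * (1 / 2) \<le> mgf N Y t ^ n * (1 - (\<rho> ^ n + \<sigma> ^ n))"
      using elim pos[of t] by (intro mult_left_mono) auto
    ultimately have "mgf N Y t ^ n / 2 \<le> exp (t * (n * (m + \<kappa>))) * q"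
      by simp
    then have "exp (- (t * (n * (m + \<kappa>)))) * (mgf N Y t ^ n / 2)
        \<le> exp (- (t * (n * (m + \<kappa>)))) * (exp (t * (n * (m + \<kappa>))) * q)"
      by (intro mult_left_mono) auto
    also have "\<dots> = q"
      by (simp add: mult.assoc[symmetric] exp_add[symmetric])
    also have "exp (- (t * (n * (m + \<kappa>)))) = exp (- t * (m + \<kappa>)) ^ n"
      by (simp add: exp_of_nat_mult[symmetric] mult_ac)
    finally show ?case
      unfolding q_def[symmetric] by (simp add: power_mult_distrib mult.commute)
  qed
qed

text \<open>One half of \<eta> buys the existence of a tilting parameter for
  \<open>c - \<eta> / 2\<close>, the other half leaves room for the window around the tilted mean
  \<open>m\<close>. Since \<open>t * m \<le> t * c\<close>, tilting costs no more than the Chernoff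
  bound at \<open>c\<close>, up to \<delta>.\<close>

lemma eventually_tail_ge_cramer:
  fixes c \<eta> \<delta> :: real
  assumes "prob_space N" "prob_space N'" and Y: "bounded_rv N Y" and iid: "iid_copies N' Ys N Y"
    and l: "l > 0" and le: "\<And>t. t \<ge> 0 \<Longrightarrow> l \<le> mgf N Y t * exp (- t * c)"
    and \<eta>: "\<eta> > 0" and \<delta>: "\<delta> > 0"
  obtains t where "t \<ge> 0" "\<forall>\<^sub>F n in sequentially.
    (mgf N Y t * exp (- t * c)) ^ n \<le> exp (n * \<delta>) * \<P>(\<omega> in N'. avg Ys n \<omega> \<ge> c - \<eta>)"
proof -
  interpret N: prob_space N by fact
  interpret N': prob_space N' by fact
  obtain t m where t: "t \<ge> 0" and m: "m \<ge> c - \<eta> / 2" "t * m = t * (c - \<eta> / 2)"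
    "((\<lambda>u. ln (mgf N Y u)) has_real_derivative m) (at t)"
    using N.exists_tilting_parameter[OF Y l le, where \<eta> = "\<eta> / 2"] \<eta> by auto
  \<comment> \<open>The first bound keeps \<open>m - \<kappa>\<close> above
    \<open>c - \<eta>\<close>; the second keeps the cost \<open>t * \<kappa>\<close> below
    \<open>\<delta> / 2\<close>, with \<open>t + 1\<close> as denominator to allow
    \<open>t = 0\<close>.\<close>
  define \<kappa> where "\<kappa> = min (\<eta> / 2) (\<delta> / (2 * (t + 1)))"
  have "\<kappa> > 0"
    using \<eta> \<delta> t by (simp add: \<kappa>_def)
  have "t * \<kappa> \<le> (t + 1) * (\<delta> / (2 * (t + 1)))"
    using t \<open>\<kappa> > 0\<close> by (intro mult_mono) (auto simp: \<kappa>_def)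
  also have "\<dots> = \<delta> / 2"
    using t by (simp add: field_simps)
  finally have t\<kappa>: "t * \<kappa> \<le> \<delta> / 2" .
  \<comment> \<open>The remaining \<open>\<delta> / 2\<close> absorbs the factor 2 that is lost in
    the tilted estimate.\<close>
  have "(\<lambda>n. exp (- \<delta> / 2) ^ n) \<longlonglongrightarrow> 0"
    using \<delta> by (intro LIMSEQ_power_zero) auto
  then have "\<forall>\<^sub>F n in sequentially. exp (- \<delta> / 2) ^ n < 1 / 2"
    by (rule order_tendstoD) simp
  with eventually_tail_ge_tilted[OF assms(1,2) Y iid t m(3) \<open>\<kappa> > 0\<close>]
  have "\<forall>\<^sub>F n in sequentially. (mgf N Y t * exp (- t * c)) ^ n
      \<le> exp (n * \<delta>) * \<P>(\<omega> in N'. avg Ys n \<omega> \<ge> c - \<eta>)"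
    using eventually_gt_at_top[of 0]
  proof eventually_elim
    case (elim n)
    have meas: "{\<omega> \<in> space N'. avg Ys n \<omega> \<ge> c - \<eta>} \<in> N'.events"
      using iid_copies_measurable_sum[OF assms(1,2) Y iid, of n] elim by (simp add: avg_ge_iff)
    have "t * m = t * c - t * \<eta> / 2"
      using m(2) by (simp add: algebra_simps)
    moreover have "t * \<eta> \<ge> 0"
      using t \<eta> by simp
    ultimately have "exp (- t * c) \<le> exp (\<delta> / 2) * exp (- t * (m + \<kappa>))"
      using t\<kappa> by (simp add: exp_add[symmetric] distrib_left)
    then have "mgf N Y t * exp (- t * c) \<le> mgf N Y t * (exp (\<delta> / 2) * exp (- t * (m + \<kappa>)))"
      using N.mgf_pos[OF Y, of t] by (intro mult_left_mono) auto
    then have "(mgf N Y t * exp (- t * c)) ^ n \<le> (mgf N Y t * (exp (\<delta> / 2) * exp (- t * (m + \<kappa>)))) ^ n"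
      using N.mgf_pos[OF Y, of t] by (intro power_mono) auto
    also have "\<dots> = (2 * exp (\<delta> / 2) ^ n) * ((mgf N Y t * exp (- t * (m + \<kappa>))) ^ n / 2)"
      by (simp add: power_mult_distrib)
    also have "\<dots> \<le> (2 * exp (\<delta> / 2) ^ n) * \<P>(\<omega> in N'. avg Ys n \<omega> \<ge> m - \<kappa>)"
      using elim by (intro mult_left_mono) auto
    also have "\<dots> \<le> exp (n * \<delta>) * \<P>(\<omega> in N'. avg Ys n \<omega> \<ge> c - \<eta>)"
    proof (intro mult_mono N'.finite_measure_mono meas)
      have "2 * exp (\<delta> / 2) ^ n \<le> exp (\<delta> / 2) ^ n * exp (\<delta> / 2) ^ n"
        using elim by (intro mult_right_mono) (auto simp: exp_minus field_simps)
      also have "\<dots> = exp (n * \<delta>)"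
        by (simp add: exp_of_nat_mult[symmetric] exp_add[symmetric])
      finally show "2 * exp (\<delta> / 2) ^ n \<le> exp (n * \<delta>)" .
      have "\<kappa> \<le> \<eta> / 2" by (simp only: \<kappa>_def min.cobounded1)
      then show "{\<omega> \<in> space N'. m - \<kappa> \<le> avg Ys n \<omega>} \<subseteq> {\<omega> \<in> space N'. c - \<eta> \<le> avg Ys n \<omega>}"
        using m(1) by auto
    qed auto
    finally show ?case .
  qed
  with t show ?thesis by (rule that)
qed

section \<open>Comparison of the tails at a fixed threshold\<close>

text \<open>The Chernoff bound for the \<open>X\<close>-tail holds for every \<open>t\<close>, hence
  for the \<open>t\<close> that Cramer's lower bound selects for \<open>Y\<close>. If the Chernoff
  bounds for \<open>Y\<close> have infimum 0, no such \<open>t\<close> is needed, because then the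
  \<open>X\<close>-tail vanishes.\<close>

lemma eventually_tail_le_tail:
  fixes c R \<eta> \<delta> :: real
  assumes "prob_space M" "prob_space M'" "prob_space N" "prob_space N'"
    and X: "bounded_rv M X" and Y: "bounded_rv N Y"
    and iidX: "iid_copies M' Xs M X" and iidY: "iid_copies N' Ys N Y"
    and dom: "\<And>t. t \<ge> 0 \<Longrightarrow> mgf M X t \<le> exp R * mgf N Y t" and \<eta>: "\<eta> > 0" and \<delta>: "\<delta> > 0"
  shows "\<forall>\<^sub>F n in sequentially.
    \<P>(\<omega> in M'. avg Xs n \<omega> \<ge> c) \<le> exp (n * (R + \<delta>)) * \<P>(\<omega> in N'. avg Ys n \<omega> \<ge> c - \<eta>)"
proof -
  interpret M: prob_space M by fact
  interpret M': prob_space M' by fact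
  interpret N: prob_space N by fact
  have p_le: "\<P>(\<omega> in M'. avg Xs n \<omega> \<ge> c) \<le> (exp R * (mgf N Y t * exp (- t * c))) ^ n"
    if "t \<ge> 0" "n > 0" for t n
  proof -
    have "\<P>(\<omega> in M'. avg Xs n \<omega> \<ge> c) = \<P>(\<omega> in M'. (\<Sum>i=1..n. Xs i \<omega>) \<ge> n * c)"
      using that by (simp add: avg_ge_iff)
    also have "\<dots> \<le> mgf M X t ^ n * exp (- t * (n * c))"
      using M'.chernoff_bound[OF iid_copies_measurable_sum iid_copies_integrable_exp_sum,
          OF assms(1,2) X iidX assms(1,2) X iidX that(1), where a = "real n * c"]
      by (simp only: iid_copies_mgf_sum_eq[OF assms(1,2) X iidX])
    also have "\<dots> = (mgf M X t * exp (- t * c)) ^ n"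
      by (simp add: power_mult_distrib exp_of_nat_mult[symmetric] mult_ac)
    also have "\<dots> \<le> (exp R * mgf N Y t * exp (- t * c)) ^ n"
      using dom[OF that(1)] M.mgf_pos[OF X, of t] by (intro power_mono mult_right_mono) auto
    finally show ?thesis by (simp add: mult.assoc)
  qed
  show ?thesis
  proof (cases "\<exists>l>0. \<forall>t\<ge>0. l \<le> mgf N Y t * exp (- t * c)")
    case True
    then obtain l where l: "l > 0" "\<And>t. t \<ge> 0 \<Longrightarrow> l \<le> mgf N Y t * exp (- t * c)" by blast
    obtain t where t: "t \<ge> 0" "\<forall>\<^sub>F n in sequentially.
        (mgf N Y t * exp (- t * c)) ^ n \<le> exp (n * \<delta>) * \<P>(\<omega> in N'. avg Ys n \<omega> \<ge> c - \<eta>)"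
      using eventually_tail_ge_cramer[OF assms(3,4) Y iidY l \<eta> \<delta>] .
    from t(2) show ?thesis
      using eventually_gt_at_top[of 0]
    proof eventually_elim
      case (elim n)
      have "\<P>(\<omega> in M'. avg Xs n \<omega> \<ge> c) \<le> exp R ^ n * (mgf N Y t * exp (- t * c)) ^ n"
        using p_le[OF t(1) elim(2)] by (simp add: power_mult_distrib)
      also have "\<dots> \<le> exp R ^ n * (exp (n * \<delta>) * \<P>(\<omega> in N'. avg Ys n \<omega> \<ge> c - \<eta>))"
        using elim by (intro mult_left_mono) auto
      finally show ?case
        by (simp add: exp_of_nat_mult[symmetric] exp_add distrib_left mult.assoc)
    qed
  next
    case False
    have "\<P>(\<omega> in M'. avg Xs n \<omega> \<ge> c) \<le> 0" if n: "n > 0" for n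
    proof (rule field_le_epsilon)
      fix e :: real assume "e > 0"
      \<comment> \<open>The factor \<open>exp (- R)\<close> cancels \<open>exp R\<close> in
        \<open>p_le\<close>; the cap at 1 makes the \<open>n\<close>-th power at most the first
        power, hence at most \<open>e\<close>.\<close>
      define l where "l = min e 1 * exp (- R)"
      have "l > 0"
        using \<open>e > 0\<close> by (simp add: l_def)
      then obtain t where t: "t \<ge> 0" "mgf N Y t * exp (- t * c) < l"
        using False by (auto simp: not_le)
      have "exp R * (mgf N Y t * exp (- t * c)) \<le> min e 1"
        using t(2) by (simp add: l_def exp_minus field_simps)
      then have "(exp R * (mgf N Y t * exp (- t * c))) ^ n \<le> min e 1 ^ n"
        using N.mgf_pos[OF Y, of t] by (intro power_mono) auto
      also have "\<dots> \<le> min e 1 ^ 1"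
        using n \<open>e > 0\<close> by (intro power_decreasing) auto
      finally show "\<P>(\<omega> in M'. avg Xs n \<omega> \<ge> c) \<le> 0 + e"
        using p_le[OF t(1) n] by simp
    qed
    then have "\<P>(\<omega> in M'. avg Xs n \<omega> \<ge> c) \<le> exp (n * (R + \<delta>)) * \<P>(\<omega> in N'. avg Ys n \<omega> \<ge> c - \<eta>)"
      if "n > 0" for n
      using that by (intro order_trans[OF _ mult_nonneg_nonneg]) auto
    with eventually_gt_at_top[of 0] show ?thesis
      by (rule eventually_mono)
  qed
qed

section \<open>Bounded averages and logarithms of quotients\<close>

lemma iid_copies_AE_avg_bounded:
  assumes "prob_space M" "prob_space M'" and X: "X \<in> borel_measurable M" and iid: "iid_copies M' Xs M X"
    and B: "AE \<omega> in M. \<bar>X \<omega>\<bar> \<le> B" and n: "n > 0"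
  shows "AE \<omega> in M'. \<bar>avg Xs n \<omega>\<bar> \<le> B"
proof -
  have "AE \<omega> in M'. \<forall>i\<in>{1..n}. \<bar>Xs i \<omega>\<bar> \<le> B"
  proof (rule AE_finite_allI)
    fix i assume "i \<in> {1..n}"
    then have Xs: "Xs i \<in> borel_measurable M'" and distr: "distr M' borel (Xs i) = distr M borel X"
      using iid iid_copies_measurable[OF assms(2) iid] by (auto simp: iid_copies_def)
    have "AE x in distr M borel X. \<bar>x\<bar> \<le> B"
      using B X by (subst AE_distr_iff) auto
    then show "AE \<omega> in M'. \<bar>Xs i \<omega>\<bar> \<le> B"
      unfolding distr[symmetric] using Xs by (subst (asm) AE_distr_iff) auto
  qed simp
  then show ?thesis
  proof eventually_elim
    case (elim \<omega>)
    have "\<bar>\<Sum>i=1..n. Xs i \<omega>\<bar> \<le> (\<Sum>i=1..n. \<bar>Xs i \<omega>\<bar>)"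
      by (rule sum_abs)
    also have "\<dots> \<le> (\<Sum>i=1..n. B)"
      using elim by (intro sum_mono) auto
    finally show ?case
      using n by (simp add: avg_def abs_mult field_simps)
  qed
qed

text \<open>Trades extended reals for a product inequality that also encodes the conventions:
  \<open>p = 0\<close> makes both sides true, including \<open>q = 0\<close>, while
  \<open>q = 0 < p\<close> makes both false.\<close>

lemma ext_log_quotient_le_iff:
  fixes p q a L :: real
  assumes "p \<ge> 0" "q \<ge> 0" "a > 0"
  shows "ereal (1 / a) * ext_log (ereal p / ereal q) \<le> ereal L \<longleftrightarrow> p \<le> exp (a * L) * q"
proof (cases "p = 0 \<or> q = 0")
  case True
  then show ?thesis
    using assms by (cases "p = 0") (auto simp: ext_log_def ereal_quotient_conventions zero_ereal_def[symmetric] divide_ereal_def)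
next
  case False
  then have pq: "p > 0" "q > 0"
    using assms by auto
  then have "ereal (1 / a) * ext_log (ereal p / ereal q) = ereal (ln (p / q) / a)"
    by (simp add: ext_log_def not_le zero_less_divide_iff)
  also have "\<dots> \<le> ereal L \<longleftrightarrow> ln (p / q) \<le> a * L"
    using assms by (simp add: field_simps)
  also have "\<dots> \<longleftrightarrow> p / q \<le> exp (a * L)"
    using pq by (metis divide_pos_pos exp_gt_zero ln_exp ln_le_cancel_iff)
  also have "\<dots> \<longleftrightarrow> p \<le> exp (a * L) * q"
    using pq by (simp add: field_simps)
  finally show ?thesis .
qed

section \<open>Uniformity in the threshold and the upper bound for the limsup\<close>

locale iid_comparison =
  fixes M :: "'a measure" and X :: "'a \<Rightarrow> real"
    and M' :: "'b measure" and Xs :: "nat \<Rightarrow> 'b \<Rightarrow> real"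
    and N :: "'c measure" and Y :: "'c \<Rightarrow> real"
    and N' :: "'d measure" and Ys :: "nat \<Rightarrow> 'd \<Rightarrow> real"
  assumes prob: "prob_space M" "prob_space M'" "prob_space N" "prob_space N'"
    and X: "bounded_rv M X" and Y: "bounded_rv N Y"
    and iidX: "iid_copies M' Xs M X" and iidY: "iid_copies N' Ys N Y"
begin

sublocale M: prob_space M by (rule prob(1))
sublocale M': prob_space M' by (rule prob(2))
sublocale N: prob_space N by (rule prob(3))
sublocale N': prob_space N' by (rule prob(4))

abbreviation tail_X :: "nat \<Rightarrow> real \<Rightarrow> real" where
  "tail_X n c \<equiv> \<P>(\<omega> in M'. avg Xs n \<omega> \<ge> c)"

abbreviation tail_Y :: "nat \<Rightarrow> real \<Rightarrow> real" where
  "tail_Y n c \<equiv> \<P>(\<omega> in N'. avg Ys n \<omega> \<ge> c)"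

lemma log_tail_ratio_le_iff:
  "n > 0 \<Longrightarrow> log_tail_ratio M' Xs N' Ys \<epsilon> n c \<le> ereal L \<longleftrightarrow> tail_X n c \<le> exp (n * L) * tail_Y n (c - \<epsilon>)"
  unfolding log_tail_ratio_def by (rule ext_log_quotient_le_iff) auto

lemma log_mgf_ratio_le_iff:
  "ext_log (ereal (mgf M X t) / ereal (mgf N Y t)) \<le> ereal L \<longleftrightarrow> mgf M X t \<le> exp L * mgf N Y t"
  using ext_log_quotient_le_iff[of "mgf M X t" "mgf N Y t" 1 L] by (simp add: one_ereal_def[symmetric])

lemma avg_measurable: "avg Xs n \<in> borel_measurable M'" "avg Ys n \<in> borel_measurable N'"
  using iid_copies_measurable_sum[OF prob(1,2) X iidX, of n] iid_copies_measurable_sum[OF prob(3,4) Y iidY, of n]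
  unfolding avg_def by auto

lemma tail_antimono:
  assumes "c \<le> d"
  shows "tail_X n d \<le> tail_X n c" "tail_Y n d \<le> tail_Y n c"
  using assms avg_measurable
  by (auto intro!: M'.finite_measure_mono N'.finite_measure_mono)

text \<open>Outside an interval that does not depend on \<open>n\<close> the tails are trivial, so
  only thresholds in a compact set need an estimate.\<close>

lemma tail_extremes:
  obtains B where "B > 0" "\<And>n c. n > 0 \<Longrightarrow> c > B \<Longrightarrow> tail_X n c = 0"
    "\<And>n c. n > 0 \<Longrightarrow> c \<le> - B \<Longrightarrow> tail_X n c = 1" "\<And>n c. n > 0 \<Longrightarrow> c \<le> - B \<Longrightarrow> tail_Y n c = 1"
proof -
  obtain B1 where B1: "B1 \<ge> 0" "AE \<omega> in M. \<bar>X \<omega>\<bar> \<le> B1"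
    using M.bounded_rv_exp_le[OF X] .
  obtain B2 where B2: "B2 \<ge> 0" "AE \<omega> in N. \<bar>Y \<omega>\<bar> \<le> B2"
    using N.bounded_rv_exp_le[OF Y] .
  define B where "B = max B1 B2 + 1"
  show ?thesis
  proof (rule that[of B])
    show "B > 0" using B1 by (simp add: B_def)
    fix n :: nat and c :: real assume n: "n > 0"
    have AE_X: "AE \<omega> in M'. \<bar>avg Xs n \<omega>\<bar> \<le> B1"
      using iid_copies_AE_avg_bounded[OF prob(1,2) M.bounded_rv_measurable[OF X] iidX B1(2) n] .
    have AE_Y: "AE \<omega> in N'. \<bar>avg Ys n \<omega>\<bar> \<le> B2"
      using iid_copies_AE_avg_bounded[OF prob(3,4) N.bounded_rv_measurable[OF Y] iidY B2(2) n] .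
    note [measurable] = avg_measurable
    show "tail_X n c = 0" if "c > B"
      using AE_X that by (subst M'.prob_eq_0) (auto elim!: eventually_mono simp: B_def)
    show "tail_X n c = 1" if "c \<le> - B"
      using AE_X that by (subst M'.prob_eq_1) (auto elim!: eventually_mono simp: B_def)
    show "tail_Y n c = 1" if "c \<le> - B"
      using AE_Y that by (subst N'.prob_eq_1) (auto elim!: eventually_mono simp: B_def)
  qed
qed

text \<open>The parameter \<open>n * t\<close> cancels the factor \<open>1 / n\<close> in the
  average.\<close>

lemma mgf_avg:
  assumes "n > 0"
  shows "integrable M' (\<lambda>\<omega>. exp (n * t * avg Xs n \<omega>))" "mgf M' (avg Xs n) (n * t) = mgf M X t ^ n"
    and "integrable N' (\<lambda>\<omega>. exp (n * t * avg Ys n \<omega>))" "mgf N' (avg Ys n) (n * t) = mgf N Y t ^ n"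
  using assms iid_copies_integrable_exp_sum[OF prob(1,2) X iidX, where n = n and t = t]
    iid_copies_mgf_sum_eq[OF prob(1,2) X iidX, where n = n and t = t]
    iid_copies_integrable_exp_sum[OF prob(3,4) Y iidY, where n = n and t = t]
    iid_copies_mgf_sum_eq[OF prob(3,4) Y iidY, where n = n and t = t]
  by (simp_all add: avg_def mult.commute)

text \<open>
  Monotonicity of the tails reduces the uniformity in \<open>c\<close> to the finitely many points of a grid
  of mesh \<open>\<epsilon> / 2\<close>; the other half of \<open>\<epsilon>\<close> is spent on the tail bound at a grid point.
\<close>
lemma eventually_tail_le_tail_uniform:
  fixes R \<epsilon> \<delta> :: real
  assumes dom: "\<And>t. t \<ge> 0 \<Longrightarrow> mgf M X t \<le> exp R * mgf N Y t" and \<epsilon>: "\<epsilon> > 0" and \<delta>: "\<delta> > 0"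
  shows "\<forall>\<^sub>F n in sequentially. \<forall>c. tail_X n c \<le> exp (n * (R + \<delta>)) * tail_Y n (c - \<epsilon>)"
proof -
  \<comment> \<open>At \<open>t = 0\<close> both moment generating functions equal 1. The sign of
    \<open>R\<close> settles thresholds so low that the \<open>Y\<close>-tail is 1.\<close>
  have "R \<ge> 0"
    using dom[of 0] by (simp add: M.prob_space N.prob_space)
  obtain B where B: "B > 0" "\<And>n c. n > 0 \<Longrightarrow> c > B \<Longrightarrow> tail_X n c = 0"
    "\<And>n c. n > 0 \<Longrightarrow> c \<le> - B \<Longrightarrow> tail_Y n c = 1"
    using tail_extremes by metis
  define g where "g k = - B + real k * (\<epsilon> / 2)" for k
  \<comment> \<open>Enough grid steps of length \<open>\<epsilon> / 2\<close> to get from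
    \<open>- B\<close> to \<open>B\<close>.\<close>
  define K where "K = nat \<lceil>2 * B / (\<epsilon> / 2)\<rceil>"
  have "\<forall>\<^sub>F n in sequentially. \<forall>k\<in>{..K}. tail_X n (g k) \<le> exp (n * (R + \<delta>)) * tail_Y n (g k - \<epsilon> / 2)"
    using \<epsilon> by (intro eventually_ball_finite ballI
        eventually_tail_le_tail[OF prob X Y iidX iidY dom _ \<delta>]) auto
  then show ?thesis
    using eventually_gt_at_top[of 0]
  proof eventually_elim
    case (elim n)
    show ?case
    proof
      fix c
      consider "c > B" | "c \<le> - B" | "- B < c" "c \<le> B" by linarith
      then show "tail_X n c \<le> exp (n * (R + \<delta>)) * tail_Y n (c - \<epsilon>)"
      proof cases
        case 1
        then show ?thesis using B elim by simp
      next
        case 2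
        have "tail_X n c \<le> 1" by simp
        also have "\<dots> \<le> exp (n * (R + \<delta>))"
          using \<open>R \<ge> 0\<close> \<delta> by simp
        finally show ?thesis
          using 2 B(3)[of n "c - \<epsilon>"] elim \<epsilon> by simp
      next
        case 3
        define k where "k = nat \<lfloor>(c + B) / (\<epsilon> / 2)\<rfloor>"
        have k0: "(c + B) / (\<epsilon> / 2) \<ge> 0"
          using 3 \<epsilon> by simp
        then have "real k \<le> (c + B) / (\<epsilon> / 2)" "(c + B) / (\<epsilon> / 2) < real k + 1"
          unfolding k_def by (simp_all add: of_nat_nat)
        then have gk: "g k \<le> c" "c \<le> g k + \<epsilon> / 2"
          using \<epsilon> by (simp_all add: g_def field_simps)
        have "(c + B) / (\<epsilon> / 2) \<le> 2 * B / (\<epsilon> / 2)"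
          using 3 \<epsilon> by (intro divide_right_mono) auto
        then have "k \<in> {..K}"
          unfolding k_def K_def by (simp only: atMost_iff) (intro nat_mono, linarith)
        then have "tail_X n (g k) \<le> exp (n * (R + \<delta>)) * tail_Y n (g k - \<epsilon> / 2)"
          using elim by blast
        \<comment> \<open>The grid point \<open>g k\<close> lies at most
          \<open>\<epsilon> / 2\<close> below \<open>c\<close>, hence
          \<open>c - \<epsilon> \<le> g k - \<epsilon> / 2\<close>.\<close>
        also have "\<dots> \<le> exp (n * (R + \<delta>)) * tail_Y n (c - \<epsilon>)"
          using gk by (intro mult_left_mono tail_antimono) auto
        finally show ?thesis
          using tail_antimono(1)[OF gk(1), of n] by linarith
      qed
    qed
  qed
qed

text \<open>Testing against real upper bounds \<open>R\<close> of the right-hand side turns the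
  claim into the uniform tail comparison; an infinite right-hand side leaves nothing to
  prove.\<close>

lemma limsup_log_tail_ratio_le:
  assumes \<epsilon>: "\<epsilon> > 0"
  shows "limsup (\<lambda>n. SUP c. log_tail_ratio M' Xs N' Ys \<epsilon> n c)
    \<le> (SUP t\<in>{0..}. ext_log (ereal (mgf M X t) / ereal (mgf N Y t)))" (is "_ \<le> ?rhs")
proof (rule ereal_le_real)
  fix R assume "?rhs \<le> ereal R"
  then have dom: "mgf M X t \<le> exp R * mgf N Y t" if "t \<ge> 0" for t
    using that unfolding SUP_le_iff log_mgf_ratio_le_iff by simp
  show "limsup (\<lambda>n. SUP c. log_tail_ratio M' Xs N' Ys \<epsilon> n c) \<le> ereal R"
  proof (rule ereal_le_epsilon2)
    fix \<delta> :: real assume "\<delta> > 0"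
    have "\<forall>\<^sub>F n in sequentially. \<forall>c. tail_X n c \<le> exp (n * (R + \<delta>)) * tail_Y n (c - \<epsilon>)"
      by (rule eventually_tail_le_tail_uniform[OF dom \<epsilon> \<open>\<delta> > 0\<close>])
    then have "\<forall>\<^sub>F n in sequentially. (SUP c. log_tail_ratio M' Xs N' Ys \<epsilon> n c) \<le> ereal (R + \<delta>)"
      using eventually_gt_at_top[of 0]
      by eventually_elim (auto intro!: SUP_least simp: log_tail_ratio_le_iff)
    then show "limsup (\<lambda>n. SUP c. log_tail_ratio M' Xs N' Ys \<epsilon> n c) \<le> ereal R + ereal \<delta>"
      by (simp add: Limsup_bounded)
  qed
qed

section \<open>The lower bound for the liminf\<close>

text \<open>For \<open>t > 0\<close>, the layer-cake comparison of the averages at parameter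
  \<open>n * t\<close> gives an inequality between \<open>n\<close>-th powers, whose root no longer
  involves \<open>n\<close>.\<close>

lemma ln_mgf_le_of_tail_le:
  fixes L \<epsilon> t :: real
  assumes n: "n > 0" and t: "t \<ge> 0" and le: "\<And>c. tail_X n c \<le> exp (n * L) * tail_Y n (c - \<epsilon>)"
  shows "ln (mgf M X t) \<le> L + t * \<epsilon> + ln (mgf N Y t)"
proof (cases "t = 0")
  \<comment> \<open>The layer-cake formula requires a positive parameter. Here the claim is
    \<open>L \<ge> 0\<close>, which follows at a threshold so low that the \<open>X\<close>-tail is
    1.\<close>
  case True
  obtain B where "tail_X n (- B) = 1"
    using tail_extremes n by (metis order_refl)
  then have "1 \<le> exp (n * L) * tail_Y n (- B - \<epsilon>)"
    using le[of "- B"] by simp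
  also have "\<dots> \<le> exp (n * L) * 1"
    by (intro mult_left_mono) auto
  finally have "L \<ge> 0"
    using n by (simp add: zero_le_mult_iff)
  then show ?thesis
    using True by (simp add: M.prob_space N.prob_space)
next
  case False
  have "mgf M X t ^ n \<le> exp (n * L) * exp (n * t * \<epsilon>) * mgf N Y t ^ n"
    using mgf_le_of_tail_le[OF prob(2,4) avg_measurable mgf_avg(1,3)[OF n] _ _ le] False n t
    by (simp add: mgf_avg[OF n])
  also have "\<dots> = (exp (L + t * \<epsilon>) * mgf N Y t) ^ n"
    by (simp add: power_mult_distrib exp_add exp_of_nat_mult[symmetric] mult.assoc)
  finally have "mgf M X t \<le> exp (L + t * \<epsilon>) * mgf N Y t"
    using n M.mgf_pos[OF X, of t] N.mgf_pos[OF Y, of t] by (simp add: power_mono_iff)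
  then have "ln (mgf M X t) \<le> ln (exp (L + t * \<epsilon>) * mgf N Y t)"
    using M.mgf_pos[OF X, of t] by (intro ln_mono) auto
  then show ?thesis
    using N.mgf_pos[OF Y, of t] by (simp add: ln_mult)
qed

text \<open>A liminf below \<open>L + \<epsilon>\<close> yields some positive \<open>n\<close> at
  which the tails compare for every \<open>c\<close>, and one such \<open>n\<close> suffices for
  \<open>ln_mgf_le_of_tail_le\<close>.\<close>

lemma log_mgf_ratio_le_liminf:
  "(SUP t\<in>{0..}. ext_log (ereal (mgf M X t) / ereal (mgf N Y t)))
    \<le> (SUP \<epsilon>\<in>{0<..}. liminf (\<lambda>n. SUP c. log_tail_ratio M' Xs N' Ys \<epsilon> n c))" (is "_ \<le> ?lhs")
proof (rule ereal_le_real, rule SUP_least)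
  fix L t :: real assume L: "?lhs \<le> ereal L" and "t \<in> {0..}"
  then have t: "t \<ge> 0" by simp
  have "ln (mgf M X t) \<le> L + ln (mgf N Y t)"
  proof (rule field_le_epsilon)
    fix e :: real assume "e > 0"
    \<comment> \<open>\<epsilon> serves both as threshold shift, costing
      \<open>t * \<epsilon>\<close>, and as slack above \<open>L\<close>; the total loss is exactly
      \<open>e\<close>.\<close>
    define \<epsilon> where "\<epsilon> = e / (1 + t)"
    have \<epsilon>: "\<epsilon> > 0"
      using \<open>e > 0\<close> t by (simp add: \<epsilon>_def)
    have "liminf (\<lambda>n. SUP c. log_tail_ratio M' Xs N' Ys \<epsilon> n c) \<le> ereal L"
      using L \<epsilon> by (auto simp: SUP_le_iff)
    also have "\<dots> < ereal (L + \<epsilon>)"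
      using \<epsilon> by simp
    finally have "\<not> (\<forall>\<^sub>F n in sequentially. ereal (L + \<epsilon>) \<le> (SUP c. log_tail_ratio M' Xs N' Ys \<epsilon> n c))"
      using Liminf_bounded by (metis not_le)
    then obtain n where n: "n > 0" "(SUP c. log_tail_ratio M' Xs N' Ys \<epsilon> n c) < ereal (L + \<epsilon>)"
      using eventually_mono[OF eventually_gt_at_top[of 0]] by (metis not_le)
    have "log_tail_ratio M' Xs N' Ys \<epsilon> n c \<le> ereal (L + \<epsilon>)" for c
      using n(2) by (meson SUP_upper UNIV_I less_imp_le order_trans)
    then have "ln (mgf M X t) \<le> L + \<epsilon> + t * \<epsilon> + ln (mgf N Y t)"
      by (intro ln_mgf_le_of_tail_le[OF n(1) t]) (simp add: log_tail_ratio_le_iff[OF n(1)])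
    moreover have "\<epsilon> + t * \<epsilon> = e"
    proof -
      have "(1 + t) * \<epsilon> = e"
        using t by (simp add: \<epsilon>_def)
      then show ?thesis
        by (simp add: distrib_right)
    qed
    ultimately show "ln (mgf M X t) \<le> L + ln (mgf N Y t) + e"
      by linarith
  qed
  then have "exp (ln (mgf M X t)) \<le> exp (L + ln (mgf N Y t))"
    by simp
  then have "mgf M X t \<le> exp L * mgf N Y t"
    using M.mgf_pos[OF X, of t] N.mgf_pos[OF Y, of t] by (simp add: exp_add)
  then show "ext_log (ereal (mgf M X t) / ereal (mgf N Y t)) \<le> ereal L"
    by (simp only: log_mgf_ratio_le_iff)
qed

end

text \<open>Both versions follow from one cycle: the right-hand side is at most the liminf version,
  which is at most the limsup version, which is at most the right-hand side.\<close>

theorem theorem1p2: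
  fixes M :: "'a measure" and X :: "'a \<Rightarrow> real"
    and M' :: "'b measure" and Xs :: "nat \<Rightarrow> 'b \<Rightarrow> real"
    and N :: "'c measure" and Y :: "'c \<Rightarrow> real"
    and N' :: "'d measure" and Ys :: "nat \<Rightarrow> 'd \<Rightarrow> real"
  assumes "prob_space M" and "prob_space M'" and "prob_space N" and "prob_space N'"
    and "bounded_rv M X" and "bounded_rv N Y"
    and "iid_copies M' Xs M X" and "iid_copies N' Ys N Y"
  shows "(SUP \<epsilon>\<in>{0::real<..}. liminf (\<lambda>n. SUP c::real. log_tail_ratio M' Xs N' Ys \<epsilon> n c)) =
           (SUP t\<in>{0::real..}. ext_log (ereal (\<integral>\<omega>. exp (t * X \<omega>) \<partial>M) / ereal (\<integral>\<omega>. exp (t * Y \<omega>) \<partial>N)))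
       \<and> (SUP \<epsilon>\<in>{0::real<..}. limsup (\<lambda>n. SUP c::real. log_tail_ratio M' Xs N' Ys \<epsilon> n c)) =
           (SUP t\<in>{0::real..}. ext_log (ereal (\<integral>\<omega>. exp (t * X \<omega>) \<partial>M) / ereal (\<integral>\<omega>. exp (t * Y \<omega>) \<partial>N)))"
proof -
  interpret iid_comparison M X M' Xs N Y N' Ys
    using assms by (rule iid_comparison.intro)
  let ?f = "\<lambda>\<epsilon> n. SUP c. log_tail_ratio M' Xs N' Ys \<epsilon> n c"
  let ?rhs = "SUP t\<in>{0::real..}. ext_log (ereal (mgf M X t) / ereal (mgf N Y t))"
  have "?rhs \<le> (SUP \<epsilon>\<in>{0<..}. liminf (?f \<epsilon>))"
    by (rule log_mgf_ratio_le_liminf)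
  moreover have "(SUP \<epsilon>\<in>{0<..}. liminf (?f \<epsilon>)) \<le> (SUP \<epsilon>\<in>{0<..}. limsup (?f \<epsilon>))"
    by (intro SUP_mono') (simp add: Liminf_le_Limsup)
  moreover have "(SUP \<epsilon>\<in>{0<..}. limsup (?f \<epsilon>)) \<le> ?rhs"
    by (intro SUP_least limsup_log_tail_ratio_le) simp
  ultimately show ?thesis
    by (intro conjI order.antisym) (auto intro: order_trans)
qed

end
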